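(* Let $K\subset\mathbb{R}^d$ be a non-empty compact set and let $X,Y$ be random closed sets in $\mathbb{R}^d$ such that $0\in G:=Y\ominus\check X\subseteq K$. For each observation window $W$ (a non-empty compact convex subset of $\mathbb{R}^d$) let $$\widehat G^1_W=\left(Y_W\ominus\check X_{W\ominus\check K}\right)\cap K .$$ Then: (1) $G\subseteq\widehat G^1_W$ for every $W$; (2) $\widehat G^1_{W_2}\subseteq\widehat G^1_{W_1}$ whenever $W_2\supseteq W_1$; (3) if $W_i\uparrow\mathbb{R}^d$, then $\bigcap_{i\in\mathbb{N}}\widehat G^1_{W_i}=G$, and moreover $\lim_{i\to\infty}\delta_H(\widehat G^1_{W_i},G)=0$.
   Context: For $A,B\subseteq\mathbb{R}^d$: $A+B=\{a+b:a\in A,b\in B\}$, $\check A=\{-a:a\in A\}$, $A\ominus B=(A^c+B)^c=\bigcap_{b\in B}(b+A)$ (so $A\ominus\emptyset=\mathbb{R}^d$). In particular $Y\ominus\check X=\{g: g+X\subseteq Y\}$. For a set $A$ and $V\subseteq\mathbb{R}^d$, $A_V=A\cap V$, and $\check X_V$ is the reflection of $X\cap V$. A random closed set is a map $X$ from a probability space to the closed subsets of $\mathbb{R}^d$ such that $\{X\cap L\ne\emptyset\}$ is measurable for each compact $L$. All statements about random sets hold for each $\omega$. $\delta_H$ is the Hausdorff distance: $\delta_H(A,B)=\max\{\sup_{a\in A}\inf_{b\in B}\|a-b\|,\ \sup_{b\in B}\inf_{a\in A}\|a-b\|\}$. $W_i\uparrow\mathbb{R}^d$ means: $(W_i)_{i\in\mathbb{N}}$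 is a convex averaging sequence of non-empty sets (each $W_i$ compact and convex, $W_i\subset W_{i+1}$, and $\sup\{r\ge0: B(x,r)\subset W_i\text{ for some }x\in W_i\}\uparrow\infty$) such that $\bigcup_i(W_i\ominus\check L)=\mathbb{R}^d$ for every non-empty compact $L$. *)

theory Defs
  imports "HOL-Probability.Probability" "HOL-Library.Set_Algebras"
begin

text \<open>
  Minkowski addition is the set addition of \<^theory>\<open>HOL-Library.Set_Algebras\<close>. Unary minus on
  sets is the complement, so the reflection of a set about the origin is an image under negation.
\<close>

abbreviation reflect :: "'a::uminus set \<Rightarrow> 'a set"
  where "reflect A \<equiv> uminus ` A"

definition erosion :: "'a::group_add set \<Rightarrow> 'a set \<Rightarrow> 'a set"  (infixl \<open>\<ominus>\<close> 65)
  where "A \<ominus> B = - (- A + B)"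

lemma erosion_eq_INT: "A \<ominus> B = (\<Inter>b\<in>B. (+) b ` A)" for A B :: "'a::ab_group_add set"
proof -
  have "x \<in> A \<ominus> B \<longleftrightarrow> (\<forall>b\<in>B. x - b \<in> A)" for x
  proof -
    have "x \<in> - A + B \<longleftrightarrow> (\<exists>b\<in>B. x - b \<notin> A)"
    proof
      assume "\<exists>b\<in>B. x - b \<notin> A"
      then obtain b where "b \<in> B" "x - b \<in> - A" by blast
      then have "(x - b) + b \<in> - A + B" by (rule set_plus_intro[rotated])
      then show "x \<in> - A + B" by simp
    qed (force elim!: set_plus_elim)
    then show ?thesis by (simp add: erosion_def)
  qed
  moreover have "x \<in> (+) b ` A \<longleftrightarrow> x - b \<in> A" for x b
  proof
    assume "x - b \<in> A"
    then have "b + (x - b) \<in> (+) b ` A" by (rule imageI)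
    then show "x \<in> (+) b ` A" by simp
  qed auto
  ultimately show ?thesis by auto
qed

lemma erosion_reflect: "Y \<ominus> reflect X = {g. (+) g ` X \<subseteq> Y}" for X Y :: "'a::ab_group_add set"
proof -
  have "g \<in> (+) (- x) ` Y \<longleftrightarrow> g + x \<in> Y" for g x
  proof
    assume "g + x \<in> Y"
    then have "- x + (g + x) \<in> (+) (- x) ` Y" by (rule imageI)
    then show "g \<in> (+) (- x) ` Y" by simp
  qed auto
  then show ?thesis unfolding erosion_eq_INT by auto
qed

definition random_closed_set :: "'w measure \<Rightarrow> ('w \<Rightarrow> 'a::euclidean_space set) \<Rightarrow> bool"
  where "random_closed_set M X \<longleftrightarrow>
    (\<forall>\<omega>\<in>space M. closed (X \<omega>)) \<and>
    (\<forall>L. compact L \<longrightarrow> {\<omega> \<in> space M. X \<omega> \<inter> L \<noteq> {}} \<in> sets M)"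

text \<open>
  The values are extended nonnegative reals, so that the suprema and infima are the intended ones
  for arbitrary sets (an empty supremum is 0, an empty infimum is infinite).
\<close>

definition hausdorff_distance :: "'a::real_normed_vector set \<Rightarrow> 'a set \<Rightarrow> ennreal"
  where "hausdorff_distance A B =
    max (SUP a\<in>A. INF b\<in>B. ennreal (norm (a - b))) (SUP b\<in>B. INF a\<in>A. ennreal (norm (a - b)))"

definition inradius :: "'a::metric_space set \<Rightarrow> ennreal"
  where "inradius W = (SUP r\<in>{r. 0 \<le> r \<and> (\<exists>x\<in>W. cball x r \<subseteq> W)}. ennreal r)"

definition window :: "'a::euclidean_space set \<Rightarrow> bool"
  where "window W \<longleftrightarrow> W \<noteq> {} \<and> compact W \<and> convex W"

definition convex_averaging :: "(nat \<Rightarrow> 'a::euclidean_space set) \<Rightarrow> bool"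
  where "convex_averaging W \<longleftrightarrow>
    (\<forall>i. compact (W i) \<and> convex (W i)) \<and>
    (\<forall>i. W i \<subseteq> W (Suc i)) \<and>
    incseq (\<lambda>i. inradius (W i)) \<and> (\<lambda>i. inradius (W i)) \<longlonglongrightarrow> \<infinity>"

definition windows_exhaust :: "(nat \<Rightarrow> 'a::euclidean_space set) \<Rightarrow> bool"
  where "windows_exhaust W \<longleftrightarrow>
    convex_averaging W \<and> (\<forall>i. W i \<noteq> {}) \<and>
    (\<forall>L. compact L \<and> L \<noteq> {} \<longrightarrow> (\<Union>i. W i \<ominus> reflect L) = UNIV)"

definition G_hat1 :: "'a::euclidean_space set \<Rightarrow> 'a set \<Rightarrow> 'a set \<Rightarrow> 'a set \<Rightarrow> 'a set"
  where "G_hat1 K X Y W = ((Y \<inter> W) \<ominus> reflect (X \<inter> (W \<ominus> reflect K))) \<inter> K"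

end

theory Submission
  imports Defs
begin

text \<open>
  For \<open>g \<in> K\<close>, a point \<open>x\<close> with \<open>x + K \<subseteq> W\<close> automatically has \<open>g + x \<in> W\<close>. So \<open>g\<close> lies in the estimator
  iff \<open>g + x \<in> Y\<close> for those \<open>x \<in> X\<close> with \<open>x + K \<subseteq> W\<close>, and enlarging \<open>W\<close> only adds constraints. The
  estimators are therefore compact and decrease to \<open>G\<close>, and decreasing compact sets converge to
  their intersection in the Hausdorff distance.
\<close>

lemma mem_G_hat1_iff:
  "g \<in> G_hat1 K X Y W \<longleftrightarrow> g \<in> K \<and> (\<forall>x\<in>X. (+) x ` K \<subseteq> W \<longrightarrow> g + x \<in> Y)"
  unfolding G_hat1_def erosion_reflect by (auto simp: add.commute)

text \<open>For fixed \<open>x\<close> the constraint \<open>g + x \<in> Y\<close> is closed in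
  \<open>g\<close>, being the preimage of \<open>Y\<close> under a translation. The estimator cuts
  the compact set \<open>K\<close> by an intersection of such closed sets.\<close>

lemma compact_G_hat1:
  assumes "compact K" and "closed Y"
  shows "compact (G_hat1 K X Y W)"
proof -
  have "closed ((\<lambda>g. g + x) -` Y)" for x
    using assms(2) by (intro closed_vimage continuous_intros)
  then have "closed (\<Inter>x\<in>{x\<in>X. (+) x ` K \<subseteq> W}. (\<lambda>g. g + x) -` Y)"
    by blast
  with assms(1) have "compact (K \<inter> (\<Inter>x\<in>{x\<in>X. (+) x ` K \<subseteq> W}. (\<lambda>g. g + x) -` Y))"
    by (rule compact_Int_closed)
  also have "K \<inter> (\<Inter>x\<in>{x\<in>X. (+) x ` K \<subseteq> W}. (\<lambda>g. g + x) -` Y) = G_hat1 K X Y W"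
    by (auto simp: mem_G_hat1_iff)
  finally show ?thesis .
qed

lemma erosion_subset_G_hat1:
  assumes "Y \<ominus> reflect X \<subseteq> K"
  shows "Y \<ominus> reflect X \<subseteq> G_hat1 K X Y W"
  using assms by (auto simp: mem_G_hat1_iff erosion_reflect subset_iff)

lemma G_hat1_antimono: "W1 \<subseteq> W2 \<Longrightarrow> G_hat1 K X Y W2 \<subseteq> G_hat1 K X Y W1"
  by (auto simp: mem_G_hat1_iff)

text \<open>Every \<open>x \<in> X\<close> is tested at some stage: \<open>x\<close> lies in some
  \<open>W i \<ominus> reflect K\<close>, that is, \<open>x + K \<subseteq> W i\<close>, and
  membership in the estimator for that \<open>W i\<close> forces
  \<open>g + x \<in> Y\<close>.\<close>

lemma INT_G_hat1_subset:
  assumes "(\<Union>i. W i \<ominus> reflect K) = UNIV"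
  shows "(\<Inter>i. G_hat1 K X Y (W i)) \<subseteq> Y \<ominus> reflect X"
proof
  fix g assume g: "g \<in> (\<Inter>i. G_hat1 K X Y (W i))"
  have "g + x \<in> Y" if "x \<in> X" for x
  proof -
    obtain i where "(+) x ` K \<subseteq> W i"
      using assms unfolding erosion_reflect by blast
    with g that show ?thesis by (auto simp: mem_G_hat1_iff)
  qed
  then show "g \<in> Y \<ominus> reflect X" by (auto simp: erosion_reflect)
qed

text \<open>Otherwise the sets \<open>C i - U\<close> are non-empty, compact and nested, so they
  share a point, which lies in every \<open>C i\<close> but not in \<open>U\<close>.\<close>

lemma compact_decseq_subset_open:
  fixes C :: "nat \<Rightarrow> 'a::heine_borel set"
  assumes "\<And>i. compact (C i)" and "decseq C" and "open U" and "(\<Inter>i. C i) \<subseteq> U"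
  shows "\<exists>i. C i \<subseteq> U"
proof (rule ccontr)
  assume "\<nexists>i. C i \<subseteq> U"
  then have "(\<Inter>i. C i - U) \<noteq> {}"
    using assms(1-3) by (intro compact_nest compact_diff) (auto dest: decseqD)
  with assms(4) show False by blast
qed

text \<open>Since \<open>B \<subseteq> A\<close>, each point of \<open>B\<close> is its own nearest
  point in \<open>A\<close>, so only the supremum over \<open>A\<close> has to be estimated.\<close>

lemma hausdorff_distance_le:
  assumes "B \<subseteq> A" and "\<And>a. a \<in> A \<Longrightarrow> \<exists>b\<in>B. norm (a - b) \<le> e"
  shows "hausdorff_distance A B \<le> ennreal e"
proof -
  have "(INF b\<in>B. ennreal (norm (a - b))) \<le> ennreal e" if "a \<in> A" for a
    using assms(2)[OF that] by (meson INF_lower2 ennreal_leI)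
  moreover have "(INF a\<in>A. ennreal (norm (a - b))) \<le> ennreal e" if "b \<in> B" for b
    using assms(1) that by (intro INF_lower2[of b]) auto
  ultimately show ?thesis
    by (auto simp: hausdorff_distance_def intro!: SUP_least)
qed

lemma hausdorff_distance_decseq_tendsto_0:
  fixes C :: "nat \<Rightarrow> 'a::euclidean_space set"
  assumes "\<And>i. compact (C i)" and "decseq C"
  shows "(\<lambda>i. hausdorff_distance (C i) (\<Inter>i. C i)) \<longlonglongrightarrow> 0"
proof (rule order_tendstoI)
  fix a :: ennreal assume "0 < a"
  \<comment> \<open>The bound \<open>a\<close> may be infinite, and the estimate below is only a
    weak inequality. A value strictly between 0 and \<open>a\<close> is finite, hence gives a real
    radius \<open>e\<close>, and leaves room for the strict inequality.\<close>
  then obtain b where b: "0 < b" "b < a" using dense by blast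
  then obtain e where e: "b = ennreal e" "0 < e"
    by (cases b) auto
  \<comment> \<open>The open \<open>e\<close>-neighbourhood of the intersection contains some
    \<open>C n\<close>, and by monotonicity all later sets. If the intersection is empty, so is
    \<open>C n\<close>, and the distance is then 0 as a maximum of empty suprema.\<close>
  obtain n where n: "C n \<subseteq> (\<Union>g\<in>(\<Inter>i. C i). ball g e)"
    using compact_decseq_subset_open[OF assms, of "\<Union>g\<in>(\<Inter>i. C i). ball g e"] \<open>0 < e\<close>
    by (force intro: centre_in_ball[THEN iffD2])
  have "hausdorff_distance (C i) (\<Inter>i. C i) < a" if "i \<ge> n" for i
  proof -
    have "C i \<subseteq> C n" using \<open>decseq C\<close> that by (rule decseqD)
    have "\<exists>b\<in>(\<Inter>i. C i). norm (a - b) \<le> e" if "a \<in> C i" for a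
    proof -
      obtain g where "g \<in> (\<Inter>i. C i)" "a \<in> ball g e"
        using \<open>C i \<subseteq> C n\<close> n \<open>a \<in> C i\<close> by blast
      then show ?thesis
        by (intro bexI[of _ g]) (auto simp: dist_norm norm_minus_commute)
    qed
    then have "hausdorff_distance (C i) (\<Inter>i. C i) \<le> ennreal e"
      by (intro hausdorff_distance_le) auto
    with b e show ?thesis by auto
  qed
  then show "\<forall>\<^sub>F i in sequentially. hausdorff_distance (C i) (\<Inter>i. C i) < a"
    by (auto simp: eventually_sequentially)
qed auto

theorem proposition1p8:
  fixes M :: "'w measure" and K :: "'a::euclidean_space set"
    and X Y G :: "'w \<Rightarrow> 'a set"
  assumes "prob_space M"
    and "K \<noteq> {}" and "compact K"
    and "random_closed_set M X" and "random_closed_set M Y"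
    and G_def: "\<And>\<omega>. \<omega> \<in> space M \<Longrightarrow> G \<omega> = Y \<omega> \<ominus> reflect (X \<omega>)"
    and "\<And>\<omega>. \<omega> \<in> space M \<Longrightarrow> 0 \<in> G \<omega>"
    and "\<And>\<omega>. \<omega> \<in> space M \<Longrightarrow> G \<omega> \<subseteq> K"
  shows "(\<forall>\<omega>\<in>space M. \<forall>W. window W \<longrightarrow> G \<omega> \<subseteq> G_hat1 K (X \<omega>) (Y \<omega>) W) \<and>
    (\<forall>\<omega>\<in>space M. \<forall>W1 W2. window W1 \<and> window W2 \<and> W1 \<subseteq> W2 \<longrightarrow>
       G_hat1 K (X \<omega>) (Y \<omega>) W2 \<subseteq> G_hat1 K (X \<omega>) (Y \<omega>) W1) \<and>
    (\<forall>\<omega>\<in>space M. \<forall>W. windows_exhaust W \<longrightarrow>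
       (\<Inter>i. G_hat1 K (X \<omega>) (Y \<omega>) (W i)) = G \<omega> \<and>
       (\<lambda>i. hausdorff_distance (G_hat1 K (X \<omega>) (Y \<omega>) (W i)) (G \<omega>)) \<longlonglongrightarrow> 0)"
proof (intro conjI ballI allI impI; (elim conjE)?)
  fix \<omega> W assume "\<omega> \<in> space M"
  with G_def assms(8) show "G \<omega> \<subseteq> G_hat1 K (X \<omega>) (Y \<omega>) W"
    by (metis erosion_subset_G_hat1)
next
  fix \<omega> and W1 W2 :: "'a set" assume "W1 \<subseteq> W2"
  then show "G_hat1 K (X \<omega>) (Y \<omega>) W2 \<subseteq> G_hat1 K (X \<omega>) (Y \<omega>) W1"
    by (rule G_hat1_antimono)
next
  fix \<omega> and W :: "nat \<Rightarrow> 'a set" assume \<omega>: "\<omega> \<in> space M" and W: "windows_exhaust W"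
  \<comment> \<open>The exhaustion property is applied with \<open>K\<close> itself as the compact
    set \<open>L\<close>.\<close>
  have "(\<Union>i. W i \<ominus> reflect K) = UNIV"
    using W assms(2,3) by (auto simp: windows_exhaust_def)
  then show INT: "(\<Inter>i. G_hat1 K (X \<omega>) (Y \<omega>) (W i)) = G \<omega>"
    using INT_G_hat1_subset[of W K "X \<omega>" "Y \<omega>"] erosion_subset_G_hat1[of "Y \<omega>" "X \<omega>" K]
      G_def[OF \<omega>] assms(8)[OF \<omega>]
    by (intro antisym) auto
  have "incseq W"
    using W by (auto simp: windows_exhaust_def convex_averaging_def intro: incseq_SucI)
  then have "decseq (\<lambda>i. G_hat1 K (X \<omega>) (Y \<omega>) (W i))"
    unfolding decseq_def incseq_def by (blast intro!: G_hat1_antimono)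
  moreover have "compact (G_hat1 K (X \<omega>) (Y \<omega>) (W i))" for i
    using assms(3,5) \<omega> by (auto simp: random_closed_set_def intro: compact_G_hat1)
  ultimately show "(\<lambda>i. hausdorff_distance (G_hat1 K (X \<omega>) (Y \<omega>) (W i)) (G \<omega>)) \<longlonglongrightarrow> 0"
    using hausdorff_distance_decseq_tendsto_0[of "\<lambda>i. G_hat1 K (X \<omega>) (Y \<omega>) (W i)"]
    by (simp only: INT)
qed

end
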